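(* Let $N\in\mathbb{R}^{n\times m}$ with $n\le m$, let $r\in\{1,\dots,n\}$, and let $g:\mathbb{R}^{n\times m}\to\mathbb{R}\cup\{\infty\}$ be a closed proper convex function such that $g(M)<\infty$ for some $M$ with $\mathrm{rank}(M)\le r$. Assume that $D^\star$ is a minimizer of $$D\mapsto g^\ast(-D)+\tfrac12\|N+D\|_r^2-\tfrac12\|N\|_F^2\quad\text{over } D\in\mathbb{R}^{n\times m},$$ and that $\sigma_r(N+D^\star)\ne\sigma_{r+1}(N+D^\star)$ or $\sigma_r(N+D^\star)=0$. Then there is no duality gap, i.e. $$\min_{\substack{M\in\mathbb{R}^{n\times m}\\ \mathrm{rank}(M)\le r}}\left[\tfrac12\|N-M\|_F^2+g(M)\right]=-\min_{D\in\mathbb{R}^{n\times m}}\left[g^\ast(-D)+\tfrac12\|N+D\|_r^2-\tfrac12\|N\|_F^2\right],$$ and $\mathrm{svd}_r(N+D^\star)$ (which is a single matrix) is the unique minimizer of the rank-constrained problem: $$\mathrm{svd}_r(N+D^\star)=\operatorname*{argmin}_{\substack{M\in\mathbb{R}^{n\times m}\\ \mathrm{rank}(M)\le r}}\left[\tfrac12\|N-M\|_F^2+g(M)\right].$$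
   Context: Matrices are real, $n\times m$ with $n\le m$; $\sigma_1(X)\ge\dots\ge\sigma_n(X)\ge 0$ are the singular values of $X$ counted with multiplicity; for $r=n$ use the convention $\sigma_{n+1}(X)=0$. $\langle X,Y\rangle=\mathrm{trace}(X^{\mathsf T}Y)$ and $\|\cdot\|_F$ is the Frobenius norm. For $r\in\{1,\dots,n\}$, $\|M\|_r:=\sqrt{\sum_{i=1}^r\sigma_i^2(M)}$. A function is closed, proper, convex if its epigraph is closed, non-empty, convex respectively. The conjugate is $g^\ast(D):=\sup_M[\langle D,M\rangle-g(M)]$. The set of standard rank-$r$ SVD-approximations of $X$ is $$\mathrm{svd}_r(X):=\left\{\sum_{i=1}^r\sigma_i(X)u_iv_i^{\mathsf T}: X=\sum_{i=1}^n\sigma_i(X)u_iv_i^{\mathsf T}\text{ is an SVD of }X\right\}.$$ When $\sigma_r(X)\ne\sigma_{r+1}(X)$ or $\sigma_r(X)=0$ this set is a singleton and $\mathrm{svd}_r(X)$ also denotes its unique element. $\operatorname{argmin}$ denotes the set of minimizers; a singleton set is identified with its element. *)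

theory Defs
  imports "HOL-Analysis.Analysis" "HOL-Computational_Algebra.Computational_Algebra"
begin

text \<open>
  A real $n \times m$ matrix is an element of the type \<open>real ^ 'm ^ 'n\<close>, with
  $n$ = \<open>CARD('n)\<close> and $m$ = \<open>CARD('m)\<close>. On this type the library's \<open>inner\<close> is the sum of the
  products of corresponding entries, that is $\mathrm{trace}(X^T Y)$, and \<open>norm\<close> is the
  Frobenius norm.
\<close>

lemma inner_matrix_eq_trace:
  fixes X Y :: "real ^ 'm ^ 'n"
  shows "X \<bullet> Y = trace (transpose X ** Y)"
  unfolding trace_def matrix_matrix_mult_def transpose_def inner_vec_def
  by (simp, rule sum.swap)

lemma norm_matrix_eq_sqrt_trace:
  fixes X :: "real ^ 'm ^ 'n"
  shows "norm X = sqrt (trace (transpose X ** X))"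
  by (simp add: norm_eq_sqrt_inner inner_matrix_eq_trace)

definition charpoly :: "real ^ 'n ^ 'n \<Rightarrow> real poly" where
  "charpoly A = det (mat [:0, 1:] - map_matrix (\<lambda>a. [:a:]) A)"

text \<open>
  The singular values of an $n \times m$ matrix $X$ with $n \le m$ are the square roots of the $n$
  eigenvalues of $X X^T$, which is positive semidefinite, so all $n$ roots of its characteristic
  polynomial are real and nonnegative. Indices start at 1, and \<open>singular_value X (n + 1) = 0\<close>.
\<close>

definition singular_value :: "real ^ 'm ^ 'n \<Rightarrow> nat \<Rightarrow> real" where
  "singular_value X i =
     (if 1 \<le> i \<and> i \<le> CARD('n)
      then rev (sorted_list_of_multiset (image_mset sqrt (proots (charpoly (X ** transpose X))))) ! (i - 1)
      else 0)"

definition rnorm :: "nat \<Rightarrow> real ^ 'm ^ 'n \<Rightarrow> real" where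
  "rnorm r M = sqrt (\<Sum>i = 1..r. (singular_value M i)\<^sup>2)"

definition outer :: "real ^ 'n \<Rightarrow> real ^ 'm \<Rightarrow> real ^ 'm ^ 'n" where
  "outer u v = (\<chi> i j. u $ i * v $ j)"

definition orthonormal_family :: "nat \<Rightarrow> (nat \<Rightarrow> 'a::real_inner) \<Rightarrow> bool" where
  "orthonormal_family k u \<longleftrightarrow>
     (\<forall>i\<in>{1..k}. \<forall>j\<in>{1..k}. u i \<bullet> u j = (if i = j then 1 else 0))"

definition is_svd :: "real ^ 'm ^ 'n \<Rightarrow> (nat \<Rightarrow> real ^ 'n) \<Rightarrow> (nat \<Rightarrow> real ^ 'm) \<Rightarrow> bool" where
  "is_svd X u v \<longleftrightarrow>
     orthonormal_family CARD('n) u \<and> orthonormal_family CARD('n) v \<and>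
     X = (\<Sum>i = 1..CARD('n). singular_value X i *\<^sub>R outer (u i) (v i))"

definition svd_approx :: "nat \<Rightarrow> real ^ 'm ^ 'n \<Rightarrow> (real ^ 'm ^ 'n) set" where
  "svd_approx r X =
     {(\<Sum>i = 1..r. singular_value X i *\<^sub>R outer (u i) (v i)) | u v. is_svd X u v}"

definition epi :: "('a \<Rightarrow> ereal) \<Rightarrow> ('a \<times> real) set" where
  "epi g = {(x, t). g x \<le> ereal t}"

text \<open>The first conjunct says that \<open>g\<close> takes values in $\mathbb{R} \cup \{\infty\}$.\<close>

definition closed_proper_convex :: "('a::real_normed_vector \<Rightarrow> ereal) \<Rightarrow> bool" where
  "closed_proper_convex g \<longleftrightarrow>
     (\<forall>x. g x \<noteq> - \<infinity>) \<and> closed (epi g) \<and> epi g \<noteq> {} \<and> convex (epi g)"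

definition conjugate :: "('a::real_inner \<Rightarrow> ereal) \<Rightarrow> 'a \<Rightarrow> ereal" where
  "conjugate g D = (SUP M. ereal (D \<bullet> M) - g M)"

definition minimizers :: "('a \<Rightarrow> ereal) \<Rightarrow> 'a set \<Rightarrow> 'a set" where
  "minimizers f S = {x \<in> S. \<forall>y\<in>S. f x \<le> f y}"

definition primal_objective ::
  "real ^ 'm ^ 'n \<Rightarrow> (real ^ 'm ^ 'n \<Rightarrow> ereal) \<Rightarrow> real ^ 'm ^ 'n \<Rightarrow> ereal" where
  "primal_objective N g M = ereal (1 / 2 * (norm (N - M))\<^sup>2) + g M"

definition dual_objective ::
  "nat \<Rightarrow> real ^ 'm ^ 'n \<Rightarrow> (real ^ 'm ^ 'n \<Rightarrow> ereal) \<Rightarrow> real ^ 'm ^ 'n \<Rightarrow> ereal" where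
  "dual_objective r N g D =
     conjugate g (- D) + ereal (1 / 2 * (rnorm r (N + D))\<^sup>2 - 1 / 2 * (norm N)\<^sup>2)"

end

theory Submission
  imports Defs
begin

text \<open>
  Put $X = N + D$ and $h(Y) = \frac12 \|Y\|_r^2$. The Eckart-Young theorem says that $h(Y)$ is the
  maximum of $\langle Y, M\rangle - \frac12\|M\|_F^2$ over matrices $M$ of rank at most $r$, attained at the
  truncated singular value decompositions of $Y$. Inserting the affine minorant
  $g(M) \ge -\langle D, M\rangle - g^*(-D)$ into the primal objective and expanding the square leaves
  $\frac12\|N\|_F^2 - g^*(-D) - (\langle X, M\rangle - \frac12\|M\|_F^2)$, whose minimum over $M$ of rank at most $r$ is
  minus the dual objective at $D$. So the theorem amounts to two facts about the truncation $S$ of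
  $X$: it is the unique maximizer in the Eckart-Young problem for $X$, and the affine minorant with
  slope $-D$ touches $g$ at $S$.

  Both come from one estimate. If $\sigma_r(X) \ne \sigma_{r+1}(X)$ or $\sigma_r(X) = 0$, the value of the
  Eckart-Young problem falls off at least quadratically with the distance from $S$
  (\<open>eckart_young_quadratic_growth\<close>). This gives uniqueness at once. It also shows
  $h(X + E) \le h(X) + \langle S, E\rangle + O(\|E\|_F^2)$ (\<open>rnorm_quadratic_upper_bound\<close>), so that optimality of $D$
  makes $S$ a subgradient of $g^*$ at $-D$. Since $g$ is closed, proper and convex, it is the
  supremum of its affine minorants (\<open>affine_minorant_above\<close>), and therefore equality holds in
  $g(S) \ge -\langle D, S\rangle - g^*(-D)$ (\<open>conjugate_subgradient_of_minimizer\<close>).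

  The singular values are defined by the roots of a characteristic polynomial. That every
  matrix has a singular value decomposition with these values rests on the spectral theorem for
  self-adjoint maps (\<open>self_adjoint_orthonormal_eigenbasis\<close>).
\<close>

(* The symbol $ is reserved for components of vectors. *)
no_notation fps_nth (infixl \<open>$\<close> 75)

section \<open>Orthonormal families and the spectral theorem\<close>

lemma orthonormal_familyD:
  assumes "orthonormal_family k u" "i \<in> {1..k}" "j \<in> {1..k}"
  shows "u i \<bullet> u j = (if i = j then 1 else 0)"
  using assms unfolding orthonormal_family_def by blast

lemma orthonormal_family_orthogonal_unit:
  fixes u :: "nat \<Rightarrow> 'a::euclidean_space"
  assumes "k < DIM('a)"
  obtains x where "norm x = 1" "\<And>i. i \<in> {1..k} \<Longrightarrow> u i \<bullet> x = 0"
proof -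
  have "dim (u ` {1..k}) \<le> card (u ` {1..k})"
    by (intro dim_le_card') auto
  also have "\<dots> \<le> k"
    using card_image_le[of "{1..k}" u] by simp
  finally have "dim (u ` {1..k}) < DIM('a)"
    using assms by simp
  then obtain x where x: "x \<noteq> 0" "\<And>y. y \<in> span (u ` {1..k}) \<Longrightarrow> orthogonal x y"
    using orthogonal_to_subspace_exists by blast
  show ?thesis
  proof (rule that[of "x /\<^sub>R norm x"])
    show "u i \<bullet> (x /\<^sub>R norm x) = 0" if "i \<in> {1..k}" for i
      using x(2)[of "u i"] that by (simp add: span_base orthogonal_def inner_commute)
  qed (use x(1) in simp)
qed

lemma orthonormal_family_Suc:
  assumes "orthonormal_family k u" "norm x = 1" "\<And>i. i \<in> {1..k} \<Longrightarrow> u i \<bullet> x = 0"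
  shows "orthonormal_family (Suc k) (u(Suc k := x))"
  using assms unfolding orthonormal_family_def
  by (auto simp: atLeastAtMostSuc_conv inner_commute norm_eq_1)

lemma orthonormal_family_extend:
  fixes u :: "nat \<Rightarrow> 'a::euclidean_space"
  assumes "orthonormal_family k u" "k \<le> n" "n \<le> DIM('a)"
  obtains v where "orthonormal_family n v" "\<And>i. i \<in> {1..k} \<Longrightarrow> v i = u i"
proof -
  have "n \<le> DIM('a) \<longrightarrow> (\<exists>v. orthonormal_family n v \<and> (\<forall>i\<in>{1..k}. v i = u i))"
    using assms(2)
  proof (induction n rule: dec_induct)
    case base
    then show ?case using assms(1) by blast
  next
    case (step n)
    show ?case
    proof
      assume n: "Suc n \<le> DIM('a)"
      then obtain v where v: "orthonormal_family n v" "\<forall>i\<in>{1..k}. v i = u i"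
        using step by auto
      obtain x where x: "norm x = 1" "\<And>i. i \<in> {1..n} \<Longrightarrow> v i \<bullet> x = 0"
        using orthonormal_family_orthogonal_unit[of n v] n by auto
      show "\<exists>v. orthonormal_family (Suc n) v \<and> (\<forall>i\<in>{1..k}. v i = u i)"
        using orthonormal_family_Suc[OF v(1) x] v(2) step.hyps by (intro exI[of _ "v(Suc n := x)"]) auto
    qed
  qed
  then show ?thesis
    using assms(3) that by blast
qed

text \<open>
  Being orthonormal makes the family independent, and an independent set of full size spans the
  space. What remains of \<open>x\<close> after subtracting its components is orthogonal to the whole span,
  hence to itself.
\<close>

lemma orthonormal_family_expansion:
  fixes u :: "nat \<Rightarrow> 'a::euclidean_space"
  assumes u: "orthonormal_family DIM('a) u"
  shows "(\<Sum>i = 1..DIM('a). (u i \<bullet> x) *\<^sub>R u i) = x"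
proof -
  let ?S = "u ` {1..DIM('a)}"
  define y where "y = x - (\<Sum>i = 1..DIM('a). (u i \<bullet> x) *\<^sub>R u i)"
  have inj: "inj_on u {1..DIM('a)}"
    using orthonormal_familyD[OF u] by (intro inj_onI) (metis zero_neq_one)
  have "pairwise orthogonal ?S"
    unfolding pairwise_def orthogonal_def using orthonormal_familyD[OF u] by fastforce
  moreover have "0 \<notin> ?S"
    using orthonormal_familyD[OF u] by force
  ultimately have ind: "independent ?S"
    by (rule pairwise_orthogonal_independent)
  have "card ?S = DIM('a)"
    using inj by (simp add: card_image)
  then have span: "span ?S = UNIV"
    using ind card_ge_dim_independent[OF _ ind, of UNIV] by auto
  have "u j \<bullet> y = 0" if j: "j \<in> {1..DIM('a)}" for j
  proof -
    have "(\<Sum>i = 1..DIM('a). (u i \<bullet> x) * (u j \<bullet> u i)) = (\<Sum>i = 1..DIM('a). if i = j then u j \<bullet> x else 0)"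
      using orthonormal_familyD[OF u j] by (intro sum.cong) auto
    then show ?thesis
      using j by (simp add: y_def inner_diff_right inner_sum_right)
  qed
  then have "\<And>z. z \<in> ?S \<Longrightarrow> orthogonal y z"
    by (auto simp: orthogonal_def inner_commute)
  then have "orthogonal y y"
    using orthogonal_to_span[of y ?S y] span by auto
  then show ?thesis
    by (simp add: orthogonal_self y_def)
qed

lemma orthonormal_family_parseval:
  fixes u :: "nat \<Rightarrow> 'a::euclidean_space"
  assumes u: "orthonormal_family DIM('a) u"
  shows "(\<Sum>i = 1..DIM('a). (u i \<bullet> x)\<^sup>2) = (norm x)\<^sup>2"
proof -
  have "(norm x)\<^sup>2 = (\<Sum>i = 1..DIM('a). (u i \<bullet> x) *\<^sub>R u i) \<bullet> x"
    by (simp only: orthonormal_family_expansion[OF u] power2_norm_eq_inner)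
  then show ?thesis
    by (simp add: inner_sum_left power2_eq_square)
qed

text \<open>
  The eigenvector is a maximizer \<open>e\<close> of the Rayleigh quotient on the unit sphere of \<open>W\<close>. With \<open>l\<close> the
  maximum, the quadratic form \<open>l * (y \<bullet> y) - y \<bullet> f y\<close> is nonnegative on \<open>W\<close> and vanishes at \<open>e\<close>, so
  its first variation at \<open>e\<close> vanishes in every direction of \<open>W\<close>. By invariance \<open>z = f e - l *\<^sub>R e\<close> is
  such a direction, and the variation along \<open>z\<close> is a multiple of \<open>z \<bullet> z\<close>.
\<close>

lemma self_adjoint_eigenvector:
  fixes f :: "'a::euclidean_space \<Rightarrow> 'a"
  assumes lin: "linear f" and adj: "\<And>x y. f x \<bullet> y = x \<bullet> f y"
    and W: "subspace W" "w \<in> W" "w \<noteq> 0" and inv: "\<And>x. x \<in> W \<Longrightarrow> f x \<in> W"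
  obtains e l where "e \<in> W" "norm e = 1" "f e = l *\<^sub>R e"
proof -
  define K where "K = sphere 0 1 \<inter> W"
  have "compact K"
    unfolding K_def by (intro compact_Int_closed closed_subspace W) auto
  moreover have "w /\<^sub>R norm w \<in> K"
    using W by (auto simp: K_def subspace_scale)
  moreover have "continuous_on K (\<lambda>x. x \<bullet> f x)"
    by (intro continuous_intros linear_continuous_on_compose[OF _ lin])
  ultimately obtain e where e: "e \<in> K" "\<And>x. x \<in> K \<Longrightarrow> x \<bullet> f x \<le> e \<bullet> f e"
    using continuous_attains_sup[of K "\<lambda>x. x \<bullet> f x"] by blast
  define l where "l = e \<bullet> f e"
  have eW: "e \<in> W" and ee: "e \<bullet> e = 1"
    using e(1) by (auto simp: K_def norm_eq_1)
  have bound: "y \<bullet> f y \<le> l * (y \<bullet> y)" if "y \<in> W" for y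
  proof (cases "y = 0")
    case False
    then have "y /\<^sub>R norm y \<in> K"
      using that W by (auto simp: K_def subspace_scale)
    from e(2)[OF this] have "(y \<bullet> f y) / (norm y * norm y) \<le> l"
      by (simp add: l_def linear_scale[OF lin] divide_simps)
    then show ?thesis
      using False by (simp add: divide_le_eq dot_square_norm power2_eq_square)
  qed (simp add: linear_0[OF lin])
  define z where "z = f e - l *\<^sub>R e"
  have zW: "z \<in> W"
    using eW inv W(1) by (simp add: z_def subspace_diff subspace_scale)
  define a where "a = z \<bullet> z"
  define c where "c = l * a - z \<bullet> f z"
  have c0: "c \<ge> 0"
    using bound[OF zW] by (simp add: c_def a_def)
  have var: "2 * t * a \<le> t\<^sup>2 * c" for t
  proof -
    have "e + t *\<^sub>R z \<in> W"
      using eW zW W(1) by (simp add: subspace_add subspace_scale)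
    from bound[OF this]
    have ineq: "l + 2 * t * (z \<bullet> f e) + t\<^sup>2 * (z \<bullet> f z) \<le> l * (1 + 2 * t * (z \<bullet> e) + t\<^sup>2 * a)"
      using adj[of e z] ee
      by (simp add: linear_add[OF lin] linear_scale[OF lin] inner_add_left inner_add_right
          l_def a_def inner_commute algebra_simps power2_eq_square)
    have zfe: "z \<bullet> f e = a + l * (z \<bullet> e)"
      by (simp add: a_def) (simp add: z_def inner_diff_right)
    show ?thesis
      using ineq unfolding zfe c_def by (simp add: algebra_simps)
  qed
  \<comment> \<open>This step length makes the linear term of the variation outweigh the quadratic one unless \<open>a = 0\<close>.\<close>
  define t where "t = a / (c + 1)"
  have a: "a = t * (c + 1)"
    using c0 by (simp add: t_def)
  have "t\<^sup>2 * (c + 2) \<le> 0"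
    using var[of t] unfolding a by (simp add: algebra_simps power2_eq_square)
  then have "t = 0"
    using c0 by (simp add: mult_le_0_iff)
  then have "a = 0"
    using a by simp
  then have "f e = l *\<^sub>R e"
    by (simp add: a_def z_def)
  then show ?thesis
    using that eW ee by (simp add: norm_eq_1)
qed

text \<open>
  The spectral theorem. As long as an orthonormal family of eigenvectors is not complete, its
  orthogonal complement is a nonzero subspace, which \<open>f\<close> maps into itself because \<open>f\<close> is
  self-adjoint, and therefore contains a further eigenvector.
\<close>

theorem self_adjoint_orthonormal_eigenbasis:
  fixes f :: "'a::euclidean_space \<Rightarrow> 'a"
  assumes lin: "linear f" and adj: "\<And>x y. f x \<bullet> y = x \<bullet> f y"
  obtains u l where "orthonormal_family DIM('a) u"
    "\<And>i. i \<in> {1..DIM('a)} \<Longrightarrow> f (u i) = l i *\<^sub>R u i"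
proof -
  have "\<exists>u l. orthonormal_family k u \<and> (\<forall>i\<in>{1..k}. f (u i) = l i *\<^sub>R u i)" if "k \<le> DIM('a)" for k
    using that
  proof (induction k)
    case 0
    then show ?case by (simp add: orthonormal_family_def)
  next
    case (Suc k)
    then obtain u l where u: "orthonormal_family k u" "\<forall>i\<in>{1..k}. f (u i) = l i *\<^sub>R u i"
      by auto
    define W where "W = {x. \<forall>i\<in>{1..k}. u i \<bullet> x = 0}"
    have W: "subspace W"
      by (auto simp: W_def subspace_def inner_add_right)
    obtain w where w: "norm w = 1" "\<And>i. i \<in> {1..k} \<Longrightarrow> u i \<bullet> w = 0"
      using orthonormal_family_orthogonal_unit[of k u] Suc.prems by auto
    have "f x \<in> W" if "x \<in> W" for x
      using that u(2) by (auto simp: W_def adj[symmetric])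
    then obtain e m where e: "e \<in> W" "norm e = 1" "f e = m *\<^sub>R e"
      using self_adjoint_eigenvector[OF lin adj W, of w] w unfolding W_def by force
    have "orthonormal_family (Suc k) (u(Suc k := e))"
      using u(1) e(1,2) by (intro orthonormal_family_Suc) (auto simp: W_def)
    moreover have "\<forall>i\<in>{1..Suc k}. f ((u(Suc k := e)) i) = (l(Suc k := m)) i *\<^sub>R (u(Suc k := e)) i"
      using u(2) e(3) by (auto simp: atLeastAtMostSuc_conv)
    ultimately show ?case by blast
  qed
  then show ?thesis
    using that by blast
qed

section \<open>Existence of singular value decompositions\<close>

lemma map_matrix_const_poly_mult:
  fixes A :: "real ^ 'k ^ 'n" and B :: "real ^ 'm ^ 'k"
  shows "map_matrix (\<lambda>a. [:a:]) (A ** B) = map_matrix (\<lambda>a. [:a:]) A ** map_matrix (\<lambda>a. [:a:]) B"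
  by (simp add: vec_eq_iff matrix_matrix_mult_def map_matrix_def sum_to_poly[symmetric] mult.commute)

text \<open>
  Let \<open>Q\<close> have the eigenvectors as columns. Over the polynomial ring, multiplying the characteristic
  matrix of \<open>A\<close> by \<open>Q\<close> on the right gives \<open>Q\<close> times the diagonal matrix of the linear factors. Taking
  determinants and cancelling the determinant of \<open>Q\<close>, which is nonzero as \<open>Q\<close> is orthogonal, gives
  the factorization, with multiplicities.
\<close>

theorem charpoly_eq_prod_eigenvalues:
  fixes A :: "real ^ 'n ^ 'n"
  assumes u: "orthonormal_family CARD('n) u"
    and eig: "\<And>i. i \<in> {1..CARD('n)} \<Longrightarrow> A *v u i = l i *\<^sub>R u i"
  shows "charpoly A = (\<Prod>i = 1..CARD('n). [:- l i, 1:])"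
proof -
  let ?C = "\<lambda>M. map_matrix (\<lambda>a. [:a:]) M :: real poly ^ 'n ^ 'n"
  \<comment> \<open>Columns are indexed by the type \<open>'n\<close>, the family by numbers from 1 to \<open>CARD('n)\<close>.\<close>
  obtain h where h: "bij_betw h (UNIV :: 'n set) {1..CARD('n)}"
    using finite_same_card_bij[of "UNIV :: 'n set" "{1..CARD('n)}"] by auto
  then have hin: "h j \<in> {1..CARD('n)}" for j
    by (auto simp: bij_betw_def)
  have hinj: "h i = h j \<longleftrightarrow> i = j" for i j
    using h by (auto simp: bij_betw_def inj_on_def)
  define Q :: "real ^ 'n ^ 'n" where "Q = (\<chi> i j. u (h j) $ i)"
  define L where "L = (\<chi> i j. if i = j then [:- l (h j), 1:] else 0 :: real poly ^ 'n ^ 'n)"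
  have AQ: "(A ** Q) $ i $ j = l (h j) * u (h j) $ i" for i j
  proof -
    have "(A ** Q) $ i $ j = (A *v u (h j)) $ i"
      by (simp add: matrix_matrix_mult_def matrix_vector_mult_def Q_def)
    then show ?thesis
      using eig[OF hin] by simp
  qed
  have "transpose Q ** Q = mat 1"
  proof -
    have "(transpose Q ** Q) $ i $ j = u (h i) \<bullet> u (h j)" for i j
      by (simp add: matrix_matrix_mult_def transpose_def Q_def inner_vec_def)
    then show ?thesis
      by (simp add: vec_eq_iff mat_def orthonormal_familyD[OF u hin hin] hinj)
  qed
  then have "?C (transpose Q) ** ?C Q = mat 1"
    by (simp add: map_matrix_const_poly_mult[symmetric])
       (simp add: vec_eq_iff mat_def map_matrix_def one_pCons)
  then have "det (?C (transpose Q)) * det (?C Q) = 1"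
    by (metis det_I det_mul)
  then have nz: "det (?C Q) \<noteq> 0"
    by auto
  have "(mat [:0, 1:] - ?C A) ** ?C Q = ?C Q ** L"
  proof -
    have "((mat [:0, 1:] - ?C A) ** ?C Q) $ i $ j = (?C Q ** L) $ i $ j" for i j
    proof -
      have "((mat [:0, 1:] - ?C A) ** ?C Q) $ i $ j
          = (\<Sum>k\<in>UNIV. (if i = k then [:0, 1:] * [:Q $ k $ j:] else 0) - [:A $ i $ k:] * [:Q $ k $ j:])"
        by (auto simp: matrix_matrix_mult_def mat_def map_matrix_def smult_diff_right intro!: sum.cong)
      also have "\<dots> = (\<Sum>k\<in>UNIV. if i = k then [:0, 1:] * [:Q $ k $ j:] else 0) - (?C A ** ?C Q) $ i $ j"
        by (simp add: matrix_matrix_mult_def map_matrix_def sum_subtractf)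
      also have "\<dots> = [:0, 1:] * [:Q $ i $ j:] - [:(A ** Q) $ i $ j:]"
        by (simp only: map_matrix_const_poly_mult[symmetric]) (simp add: map_matrix_def)
      also have "\<dots> = [:Q $ i $ j:] * [:- l (h j), 1:]"
        unfolding AQ by (simp add: Q_def)
      also have "\<dots> = (?C Q ** L) $ i $ j"
        by (simp add: matrix_matrix_mult_def L_def map_matrix_def
            if_distrib[of "\<lambda>x. _ * x"] cong: if_cong)
      finally show ?thesis .
    qed
    then show ?thesis
      by (simp add: vec_eq_iff)
  qed
  then have "charpoly A * det (?C Q) = det (?C Q) * det L"
    unfolding charpoly_def by (metis det_mul)
  then have "charpoly A = det L"
    using nz by (simp add: mult.commute)
  also have "\<dots> = (\<Prod>j\<in>UNIV. [:- l (h j), 1:])"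
    by (subst det_diagonal) (auto simp: L_def)
  also have "\<dots> = (\<Prod>i = 1..CARD('n). [:- l i, 1:])"
    using prod.reindex_bij_betw[OF h, of "\<lambda>i. [:- l i, 1:]"] by simp
  finally show ?thesis .
qed

lemma inner_matrix_vector_mult:
  fixes X :: "real ^ 'm ^ 'n"
  shows "(X *v x) \<bullet> y = x \<bullet> (transpose X *v y)"
  by (metis dot_lmul_matrix transpose_matrix_vector inner_commute)

text \<open>
  The link between singular values, which are defined from the roots of a characteristic
  polynomial, and geometry. The roots are the eigenvalues of the spectral theorem, so the sorted list
  of their square roots is a rearrangement \<open>p\<close> of the square roots listed in the order of the
  eigenbasis; permuting the eigenbasis by \<open>p\<close> puts the two in the same order.
\<close>

theorem singular_values_eigenbasis:
  fixes X :: "real ^ 'm ^ 'n"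
  obtains u where "orthonormal_family CARD('n) u"
    and "\<And>i. i \<in> {1..CARD('n)} \<Longrightarrow>
      (X ** transpose X) *v u i = (singular_value X i)\<^sup>2 *\<^sub>R u i"
    and "\<And>i. 0 \<le> singular_value X i"
    and "\<And>i j. 1 \<le> i \<Longrightarrow> i \<le> j \<Longrightarrow> singular_value X j \<le> singular_value X i"
proof -
  let ?n = "CARD('n)"
  let ?A = "X ** transpose X"
  have lin: "linear ((*v) ?A)"
    by (rule matrix_vector_mul_linear)
  have adj: "(?A *v x) \<bullet> y = x \<bullet> (?A *v y)" for x y
    by (simp add: inner_matrix_vector_mult matrix_transpose_mul transpose_transpose)
  obtain u l where "orthonormal_family DIM(real ^ 'n) u"
    "\<And>i. i \<in> {1..DIM(real ^ 'n)} \<Longrightarrow> ?A *v u i = l i *\<^sub>R u i"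
    using self_adjoint_orthonormal_eigenbasis[OF lin adj] by blast
  then have u: "orthonormal_family ?n u" and eig: "\<And>i. i \<in> {1..?n} \<Longrightarrow> ?A *v u i = l i *\<^sub>R u i"
    by auto
  have l0: "0 \<le> l i" if "i \<in> {1..?n}" for i
  proof -
    have "l i = (?A *v u i) \<bullet> u i"
      using eig[OF that] orthonormal_familyD[OF u that that] by simp
    also have "\<dots> = (transpose X *v u i) \<bullet> (transpose X *v u i)"
      by (simp only: matrix_vector_mul_assoc[symmetric] inner_matrix_vector_mult)
    finally show ?thesis by simp
  qed
  define ys where "ys = map (\<lambda>i. sqrt (l (Suc i))) [0..<?n]"
  define L where "L = rev (sorted_list_of_multiset (image_mset sqrt (proots (charpoly ?A))))"
  have "charpoly ?A = (\<Prod>i = 1..?n. [:- l i, 1:])"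
    using u eig by (rule charpoly_eq_prod_eigenvalues)
  then have "proots (charpoly ?A) = (\<Sum>i = 1..?n. {#l i#})"
    by (simp add: proots_prod)
  also have "\<dots> = (\<Sum>i<?n. {#l (Suc i)#})"
    by (simp add: sum.atLeast1_atMost_eq)
  also have "(\<Sum>i<k. {#l (Suc i)#}) = mset (map (\<lambda>i. l (Suc i)) [0..<k])" for k
    by (induction k) auto
  finally have "image_mset sqrt (proots (charpoly ?A)) = mset ys"
    by (simp add: ys_def image_mset.compositionality o_def)
  then have msL: "mset L = mset ys"
    by (simp add: L_def)
  then have lenL: "length L = ?n"
    using mset_eq_length[of L ys] by (simp add: ys_def)
  obtain p where p: "p permutes {..<?n}" "permute_list p ys = L"
    using mset_eq_permutation[OF msL] by (auto simp: ys_def)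
  have sv: "singular_value X i = L ! (i - 1)" if "i \<in> {1..?n}" for i
    using that by (simp add: singular_value_def L_def)
  define q where "q i = Suc (p (i - 1))" for i
  have q_in: "q i \<in> {1..?n}" if "i \<in> {1..?n}" for i
  proof -
    have "p (i - 1) < ?n"
      using permutes_in_image[OF p(1), of "i - 1"] that by auto
    then show ?thesis by (simp add: q_def)
  qed
  have q_inj: "q i = q j \<longleftrightarrow> i = j" if "i \<in> {1..?n}" "j \<in> {1..?n}" for i j
    using permutes_inj[OF p(1)] that by (auto simp: q_def inj_eq)
  have sq: "singular_value X i = sqrt (l (q i))" if "i \<in> {1..?n}" for i
  proof -
    have "L ! (i - 1) = ys ! (p (i - 1))"
      unfolding p(2)[symmetric]
      by (rule permute_list_nth) (use p(1) that in \<open>auto simp: ys_def\<close>)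
    also have "\<dots> = sqrt (l (q i))"
      using q_in[OF that] by (simp add: ys_def q_def)
    finally show ?thesis
      using sv[OF that] by simp
  qed
  have nonneg: "0 \<le> singular_value X i" for i
  proof (cases "i \<in> {1..?n}")
    case True
    then show ?thesis using sq[OF True] l0[OF q_in[OF True]] by simp
  qed (auto simp: singular_value_def)
  have mono: "singular_value X j \<le> singular_value X i" if "1 \<le> i" "i \<le> j" for i j
  proof (cases "j \<le> ?n")
    case True
    have "sorted (rev L)"
      by (simp add: L_def)
    then have "L ! (j - 1) \<le> L ! (i - 1)"
      by (rule sorted_rev_nth_mono) (use True that lenL in auto)
    then show ?thesis
      using sv[of i] sv[of j] True that by simp
  next
    case False
    then show ?thesis
      using nonneg[of i] by (simp add: singular_value_def)
  qed
  have "orthonormal_family ?n (u \<circ> q)"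
    using orthonormal_familyD[OF u q_in q_in] q_inj by (simp add: orthonormal_family_def)
  moreover have "?A *v (u \<circ> q) i = (singular_value X i)\<^sup>2 *\<^sub>R (u \<circ> q) i" if "i \<in> {1..?n}" for i
    using eig[OF q_in[OF that]] sq[OF that] l0[OF q_in[OF that]] by simp
  ultimately show ?thesis
    using that nonneg mono by blast
qed

lemma singular_value_nonneg: "0 \<le> singular_value X i"
  using singular_values_eigenbasis by metis

lemma singular_value_antimono: "1 \<le> i \<Longrightarrow> i \<le> j \<Longrightarrow> singular_value X j \<le> singular_value X i"
  using singular_values_eigenbasis by metis

lemma outer_inner: "outer a b \<bullet> M = a \<bullet> (M *v b)"
  by (simp add: outer_def inner_vec_def matrix_vector_mult_def sum_distrib_left algebra_simps)

lemma outer_scaleR_right: "outer a (c *\<^sub>R b) = c *\<^sub>R outer a b"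
  by (simp add: outer_def vec_eq_iff)

lemma outer_scaleR_left: "outer (c *\<^sub>R a) b = c *\<^sub>R outer a b"
  by (simp add: outer_def vec_eq_iff)

lemma outer_diff_left: "outer (a - c) b = outer a b - outer c b"
  by (simp add: outer_def vec_eq_iff algebra_simps)

lemma outer_mult_vector: "outer a b *v x = (b \<bullet> x) *\<^sub>R a"
  by (simp add: outer_def vec_eq_iff matrix_vector_mult_def inner_vec_def sum_distrib_left
      sum_distrib_right algebra_simps)

lemma matrix_mult_outer: "P ** outer a b = outer (P *v a) b"
  by (simp add: outer_def vec_eq_iff matrix_matrix_mult_def matrix_vector_mult_def
      sum_distrib_left sum_distrib_right mult_ac)

lemma outer_expansion:
  fixes X :: "real ^ 'm ^ 'n"
  assumes u: "orthonormal_family CARD('n) u"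
  shows "X = (\<Sum>i = 1..CARD('n). outer (u i) (transpose X *v u i))"
proof -
  have "X $ a $ b = (\<Sum>i = 1..CARD('n). outer (u i) (transpose X *v u i)) $ a $ b" for a b
  proof -
    have "X $ a $ b = column b X $ a"
      by (simp add: column_def)
    also have "column b X = (\<Sum>i = 1..CARD('n). (u i \<bullet> column b X) *\<^sub>R u i)"
      using orthonormal_family_expansion[of u "column b X"] u by simp
    also have "\<dots> $ a = (\<Sum>i = 1..CARD('n). outer (u i) (transpose X *v u i)) $ a $ b"
      by (simp add: outer_def column_def inner_vec_def transpose_def matrix_vector_mult_def algebra_simps)
    finally show ?thesis .
  qed
  then show ?thesis
    by (simp add: vec_eq_iff)
qed

text \<open>
  The left singular vectors form the eigenbasis \<open>u\<close> of \<open>X ** transpose X\<close>. The vectors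
  \<open>transpose X *v u i\<close> are pairwise orthogonal of length \<open>singular_value X i\<close>. Normalizing those that
  are nonzero, which are the first \<open>k\<close> because singular values decrease, gives right singular vectors.
  The remaining ones are multiplied by zero, so they can be any orthonormal completion; one
  exists because \<open>CARD('n) \<le> CARD('m)\<close>.
\<close>

theorem svd_exists:
  fixes X :: "real ^ 'm ^ 'n"
  assumes nm: "CARD('n) \<le> CARD('m)"
  obtains u v where "is_svd X u v"
proof -
  let ?n = "CARD('n)"
  let ?s = "singular_value X"
  obtain u where u: "orthonormal_family ?n u"
    and eig: "\<And>i. i \<in> {1..?n} \<Longrightarrow> (X ** transpose X) *v u i = (?s i)\<^sup>2 *\<^sub>R u i"
    using singular_values_eigenbasis[of X] by metis
  let ?w = "\<lambda>i. transpose X *v u i"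
  have w: "?w i \<bullet> ?w j = (if i = j then (?s i)\<^sup>2 else 0)" if "i \<in> {1..?n}" "j \<in> {1..?n}" for i j
  proof -
    have "?w i \<bullet> ?w j = u i \<bullet> ((X ** transpose X) *v u j)"
      by (simp only: inner_matrix_vector_mult transpose_transpose matrix_vector_mul_assoc)
    then show ?thesis
      using eig[OF that(2)] orthonormal_familyD[OF u that] by simp
  qed
  \<comment> \<open>Inserting 0 gives \<open>k = 0\<close> for the zero matrix.\<close>
  define k where "k = Max (insert 0 {i \<in> {1..?n}. 0 < ?s i})"
  have k_in: "k \<in> insert 0 {i \<in> {1..?n}. 0 < ?s i}"
    unfolding k_def by (rule Max_in) auto
  then have kn: "k \<le> ?n" by auto
  have pos: "0 < ?s i" if "i \<in> {1..k}" for i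
    using k_in that singular_value_antimono[of i k X] by fastforce
  have zero: "?s i = 0" if "i \<in> {1..?n}" "i \<notin> {1..k}" for i
  proof (rule ccontr)
    assume "?s i \<noteq> 0"
    then have "i \<in> insert 0 {i \<in> {1..?n}. 0 < ?s i}"
      using singular_value_nonneg[of X i] that by auto
    then have "i \<le> k"
      unfolding k_def by (rule Max_ge[rotated]) auto
    then show False using that by auto
  qed
  have fam: "orthonormal_family k (\<lambda>i. ?w i /\<^sub>R ?s i)"
    unfolding orthonormal_family_def
  proof (intro ballI)
    fix i j assume ij: "i \<in> {1..k}" "j \<in> {1..k}"
    then show "(?w i /\<^sub>R ?s i) \<bullet> (?w j /\<^sub>R ?s j) = (if i = j then 1 else 0)"
      using w[of i j] kn pos[of i] pos[of j] by (simp add: power2_eq_square field_simps)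
  qed
  obtain v where v: "orthonormal_family ?n v" "\<And>i. i \<in> {1..k} \<Longrightarrow> v i = ?w i /\<^sub>R ?s i"
    by (rule orthonormal_family_extend[OF fam kn]) (use nm in auto)
  have "?w i = ?s i *\<^sub>R v i" if "i \<in> {1..?n}" for i
  proof (cases "i \<in> {1..k}")
    case True
    then show ?thesis using v(2)[OF True] pos[OF True] by simp
  next
    case False
    then show ?thesis using w[OF that that] zero[OF that False] by simp
  qed
  then have "X = (\<Sum>i = 1..?n. ?s i *\<^sub>R outer (u i) (v i))"
    by (subst outer_expansion[OF u, of X]) (auto intro!: sum.cong simp: outer_scaleR_right)
  then show ?thesis
    using that u v(1) unfolding is_svd_def by blast
qed

section \<open>Quadratic growth in the Eckart-Young problem\<close>

lemma outer_inner_outer: "outer a b \<bullet> outer c d = (a \<bullet> c) * (b \<bullet> d)"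
  by (simp add: outer_inner outer_mult_vector inner_commute)

lemma inner_sum_outer:
  assumes "orthonormal_family k v"
  shows "(\<Sum>i = 1..k. outer (a i) (v i)) \<bullet> (\<Sum>i = 1..k. outer (b i) (v i)) = (\<Sum>i = 1..k. a i \<bullet> b i)"
proof -
  have "(\<Sum>i = 1..k. outer (a i) (v i)) \<bullet> (\<Sum>i = 1..k. outer (b i) (v i))
      = (\<Sum>i = 1..k. \<Sum>j = 1..k. (a i \<bullet> b j) * (v i \<bullet> v j))"
    by (simp add: inner_sum_left inner_sum_right outer_inner_outer) (rule sum.swap)
  also have "\<dots> = (\<Sum>i = 1..k. \<Sum>j = 1..k. if i = j then a i \<bullet> b j else 0)"
    using orthonormal_familyD[OF assms] by (intro sum.cong) auto
  finally show ?thesis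
    by simp
qed

lemma matrix_mult_sum_right: "P ** (\<Sum>i\<in>I. f i) = (\<Sum>i\<in>I. P ** f i)"
  for P :: "real ^ 'k ^ 'n" and f :: "'i \<Rightarrow> real ^ 'm ^ 'k"
  by (induction I rule: infinite_finite_induct) (auto simp: matrix_add_ldistrib)

lemma matrix_vector_mult_sum_left: "(\<Sum>i\<in>I. f i) *v x = (\<Sum>i\<in>I. f i *v x)"
  for f :: "'i \<Rightarrow> real ^ 'm ^ 'n"
  by (induction I rule: infinite_finite_induct) (auto simp: matrix_vector_mult_add_rdistrib)

lemma inner_matrix_mult_left: "(P ** X) \<bullet> M = X \<bullet> (transpose P ** M)"
  for X M :: "real ^ 'm ^ 'n" and P :: "real ^ 'n ^ 'n"
  by (simp add: inner_matrix_eq_trace matrix_transpose_mul matrix_mul_assoc)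

text \<open>
  The orthogonal projection onto the range of \<open>M\<close>. The last property says that its trace is the
  rank of \<open>M\<close>, in the form in which the trace is computed in an arbitrary orthonormal basis.
\<close>

lemma range_projection:
  fixes M :: "real ^ 'm ^ 'n"
  obtains P :: "real ^ 'n ^ 'n" where "transpose P = P" "P ** P = P" "P ** M = M"
    "\<And>u. orthonormal_family CARD('n) u \<Longrightarrow> (\<Sum>i = 1..CARD('n). u i \<bullet> (P *v u i)) = real (rank M)"
proof -
  let ?W = "range ((*v) M)"
  have W: "subspace ?W"
    by (intro linear_subspace_image matrix_vector_mul_linear) simp
  obtain B where B: "B \<subseteq> ?W" "pairwise orthogonal B" "\<And>x. x \<in> B \<Longrightarrow> norm x = 1"
    "independent B" "card B = dim ?W" "span B = ?W"
    using orthonormal_basis_subspace[OF W] by metis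
  define P where "P = (\<Sum>b\<in>B. outer b b)"
  have finB: "finite B"
    using B(4) by (rule independent_imp_finite)
  have Pv: "P *v x = (\<Sum>b\<in>B. (b \<bullet> x) *\<^sub>R b)" for x
    by (simp add: P_def matrix_vector_mult_sum_left outer_mult_vector)
  have bb: "b \<bullet> c = (if b = c then 1 else 0)" if "b \<in> B" "c \<in> B" for b c
    using B(2,3) that by (auto simp: pairwise_def orthogonal_def norm_eq_1)
  have "P *v c = c" if "c \<in> B" for c
  proof -
    have "P *v c = (\<Sum>b\<in>B. if b = c then c else 0)"
      unfolding Pv using bb that by (intro sum.cong) auto
    then show ?thesis
      using that finB by simp
  qed
  then have fix_W: "P *v x = x" if "x \<in> ?W" for x
    using linear_eq_on_span[OF matrix_vector_mul_linear[of P] linear_id[unfolded id_def], of B x] that B(6)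
    by auto
  have in_W: "P *v x \<in> ?W" for x
    unfolding Pv B(6)[symmetric] by (intro span_sum span_scale span_base)
  show ?thesis
  proof (rule that[of P])
    show "transpose P = P"
      unfolding P_def
      by (simp add: transpose_def vec_eq_iff outer_def mult.commute)
    show "P ** P = P"
      by (simp add: matrix_eq matrix_vector_mul_assoc[symmetric] fix_W[OF in_W])
    show "P ** M = M"
      by (simp add: matrix_eq matrix_vector_mul_assoc[symmetric] fix_W)
    show "(\<Sum>i = 1..CARD('n). u i \<bullet> (P *v u i)) = real (rank M)" if u: "orthonormal_family CARD('n) u" for u
    proof -
      have "(\<Sum>i = 1..CARD('n). u i \<bullet> (P *v u i)) = (\<Sum>i = 1..CARD('n). \<Sum>b\<in>B. (u i \<bullet> b)\<^sup>2)"
        by (simp add: Pv inner_sum_right inner_commute power2_eq_square)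
      also have "\<dots> = (\<Sum>b\<in>B. \<Sum>i = 1..CARD('n). (u i \<bullet> b)\<^sup>2)"
        by (rule sum.swap)
      also have "\<dots> = (\<Sum>b\<in>B. (norm b)\<^sup>2)"
        using orthonormal_family_parseval[of u] u by simp
      also have "\<dots> = real (rank M)"
        using B(3,5) by (simp add: rank_dim_range)
      finally show ?thesis .
    qed
  qed
qed

lemma rnorm_power2: "(rnorm r X)\<^sup>2 = (\<Sum>i = 1..r. (singular_value X i)\<^sup>2)"
  by (simp add: rnorm_def sum_nonneg)

text \<open>
  Rewriting a truncated sum as a full one with zero left factors allows
  \<open>inner_sum_outer\<close> to be applied to two sums truncated at different indices.
\<close>

lemma sum_outer_truncate:
  fixes r n :: nat and s :: "nat \<Rightarrow> real"
  assumes "r \<le> n"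
  shows "(\<Sum>i = 1..r. s i *\<^sub>R outer (u i) (v i))
       = (\<Sum>i = 1..n. outer (if i \<le> r then s i *\<^sub>R u i else 0) (v i))"
proof -
  have "(\<Sum>i = 1..n. outer (if i \<le> r then s i *\<^sub>R u i else 0) (v i))
      = (\<Sum>i = 1..r. outer (if i \<le> r then s i *\<^sub>R u i else 0) (v i))"
    by (rule sum.mono_neutral_right) (use assms in \<open>auto simp: outer_def vec_eq_iff\<close>)
  then show ?thesis
    by (simp add: outer_scaleR_left)
qed

lemma truncated_svd_inner:
  fixes X :: "real ^ 'm ^ 'n"
  assumes svd: "is_svd X u v" and r: "r \<le> CARD('n)"
    and S: "S = (\<Sum>i = 1..r. singular_value X i *\<^sub>R outer (u i) (v i))"
  shows "X \<bullet> S = (rnorm r X)\<^sup>2" "(norm S)\<^sup>2 = (rnorm r X)\<^sup>2"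
proof -
  let ?s = "singular_value X"
  let ?a = "\<lambda>k i. if i \<le> k then ?s i *\<^sub>R u i else 0"
  have u: "orthonormal_family CARD('n) u" and v: "orthonormal_family CARD('n) v"
    and X0: "X = (\<Sum>i = 1..CARD('n). ?s i *\<^sub>R outer (u i) (v i))"
    using svd unfolding is_svd_def by blast+
  have X: "X = (\<Sum>i = 1..CARD('n). outer (?a CARD('n) i) (v i))"
    using X0 by (simp only: sum_outer_truncate[OF order_refl])
  have S': "S = (\<Sum>i = 1..CARD('n). outer (?a r i) (v i))"
    using S r by (simp only: sum_outer_truncate)
  have *: "(\<Sum>i = 1..CARD('n). ?a k i \<bullet> ?a r i) = (rnorm r X)\<^sup>2" if "r \<le> k" for k
  proof -
    have "(\<Sum>i = 1..CARD('n). ?a k i \<bullet> ?a r i) = (\<Sum>i = 1..r. ?a k i \<bullet> ?a r i)"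
      by (rule sum.mono_neutral_right) (use r in auto)
    also have "\<dots> = (\<Sum>i = 1..r. (?s i)\<^sup>2)"
      using that r orthonormal_familyD[OF u] by (intro sum.cong) (auto simp: power2_eq_square)
    finally show ?thesis
      by (simp add: rnorm_power2)
  qed
  show "X \<bullet> S = (rnorm r X)\<^sup>2"
    using *[of "CARD('n)"] r inner_sum_outer[OF v, of "?a CARD('n)" "?a r"] X S' by simp
  show "(norm S)\<^sup>2 = (rnorm r X)\<^sup>2"
    using *[of r] inner_sum_outer[OF v, of "?a r" "?a r"] S' by (simp add: power2_norm_eq_inner)
qed

lemma rank_sum_outer_le:
  fixes u :: "nat \<Rightarrow> real ^ 'n" and v :: "nat \<Rightarrow> real ^ 'm"
  shows "rank (\<Sum>i = 1..r. s i *\<^sub>R outer (u i) (v i)) \<le> r"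
proof -
  let ?S = "\<Sum>i = 1..r. s i *\<^sub>R outer (u i) (v i)"
  have "?S *v x \<in> span (u ` {1..r})" for x
    unfolding matrix_vector_mult_sum_left outer_scaleR_left[symmetric] outer_mult_vector
    by (rule span_sum, intro span_scale, rule span_base) simp
  then have "rank ?S \<le> card (u ` {1..r})"
    unfolding rank_dim_range by (intro dim_le_card image_subsetI) auto
  also have "\<dots> \<le> r"
    using card_image_le[of "{1..r}" u] by simp
  finally show ?thesis .
qed

text \<open>
  As \<open>s\<close> is nonnegative and decreasing, the sum of \<open>s i * p i\<close> over weights in $[0,1]$ of total at
  most \<open>r\<close> is largest when the weights are 1 on the first \<open>r\<close> indices and 0 afterwards. The inequality bounds the distance of the weights from
  this optimum by the loss in the sum. Write $\alpha$ for the part of this distance on the head and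
  $\beta$ for the part on the tail. The loss is $\alpha - \beta$, and since the weight on the tail is at most
  the weight missing on the head, $s_r \beta \le s_{r+1} \alpha$.
\<close>

lemma weighted_sum_gap:
  fixes s p :: "nat \<Rightarrow> real"
  assumes r: "1 \<le> r" "r \<le> n"
    and anti: "\<And>i j. 1 \<le> i \<Longrightarrow> i \<le> j \<Longrightarrow> s j \<le> s i" and nonneg: "\<And>i. 0 \<le> s i"
    and p: "\<And>i. i \<in> {1..n} \<Longrightarrow> 0 \<le> p i" "\<And>i. i \<in> {1..n} \<Longrightarrow> p i \<le> 1"
    and p_sum: "(\<Sum>i = 1..n. p i) \<le> real r"
  shows "(s r - s (r + 1)) * ((\<Sum>i = 1..r. s i * (1 - p i)) + (\<Sum>i = r+1..n. s i * p i))
       \<le> 2 * s r * ((\<Sum>i = 1..r. s i) - (\<Sum>i = 1..n. s i * p i))"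
proof -
  have split: "(\<Sum>i = 1..n. f i) = (\<Sum>i = 1..r. f i) + (\<Sum>i = r+1..n. f i)" for f :: "nat \<Rightarrow> real"
    using r sum.ub_add_nat[of 1 r f "n - r"] by simp
  define \<alpha> where "\<alpha> = (\<Sum>i = 1..r. s i * (1 - p i))"
  define \<beta> where "\<beta> = (\<Sum>i = r+1..n. s i * p i)"
  have diff: "(\<Sum>i = 1..r. s i) - (\<Sum>i = 1..n. s i * p i) = \<alpha> - \<beta>"
    using split[of "\<lambda>i. s i * p i"] by (simp add: \<alpha>_def \<beta>_def right_diff_distrib sum_subtractf)
  have p_tail: "(\<Sum>i = r+1..n. p i) \<le> (\<Sum>i = 1..r. 1 - p i)"
    using p_sum split[of p] by (simp add: sum_subtractf)
  have \<beta>_le: "\<beta> \<le> s (r + 1) * (\<Sum>i = r+1..n. p i)"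
    unfolding \<beta>_def sum_distrib_left
    using p(1) by (intro sum_mono mult_right_mono anti) auto
  have \<alpha>_ge: "s r * (\<Sum>i = 1..r. 1 - p i) \<le> \<alpha>"
    unfolding \<alpha>_def sum_distrib_left
    using p(2) r by (intro sum_mono mult_right_mono anti) auto
  have "s r * \<beta> \<le> s r * (s (r + 1) * (\<Sum>i = r+1..n. p i))"
    using \<beta>_le nonneg by (rule mult_left_mono)
  also have "\<dots> \<le> s r * (s (r + 1) * (\<Sum>i = 1..r. 1 - p i))"
    using p_tail nonneg by (intro mult_left_mono)
  also have "\<dots> = s (r + 1) * (s r * (\<Sum>i = 1..r. 1 - p i))"
    by simp
  also have "\<dots> \<le> s (r + 1) * \<alpha>"
    using \<alpha>_ge nonneg by (rule mult_left_mono)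
  finally have cross: "s r * \<beta> \<le> s (r + 1) * \<alpha>" .
  have step: "s (r + 1) \<le> s r"
    using r by (intro anti) auto
  have p_head: "0 \<le> (\<Sum>i = 1..r. 1 - p i)"
    using p(2) r by (intro sum_nonneg) auto
  have "\<beta> \<le> s (r + 1) * (\<Sum>i = r+1..n. p i)"
    by (fact \<beta>_le)
  also have "\<dots> \<le> s (r + 1) * (\<Sum>i = 1..r. 1 - p i)"
    using p_tail nonneg by (intro mult_left_mono)
  also have "\<dots> \<le> s r * (\<Sum>i = 1..r. 1 - p i)"
    using step p_head by (rule mult_right_mono)
  also have "\<dots> \<le> \<alpha>"
    by (fact \<alpha>_ge)
  finally have "\<beta> \<le> \<alpha>" .
  then have "(s r - s (r + 1)) * \<beta> \<le> (s r - s (r + 1)) * \<alpha>"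
    using step by (intro mult_left_mono) auto
  moreover have "(s r - s (r + 1)) * \<alpha> \<le> s r * (\<alpha> - \<beta>)"
    using cross by (simp add: algebra_simps)
  ultimately show ?thesis
    unfolding diff \<alpha>_def[symmetric] \<beta>_def[symmetric] by (simp add: distrib_left)
qed

text \<open>
  A quantitative Eckart-Young theorem. Half of the bracket is the amount by which
  \<open>X \<bullet> M - (norm M)^2 / 2\<close> stays below its maximum \<open>(rnorm r X)^2 / 2\<close> over matrices of rank
  at most \<open>r\<close>, and this amount grows at least quadratically in the distance of \<open>M\<close> from \<open>S\<close>. So \<open>S\<close> is the only maximizer.

  Let \<open>P\<close> be the projection onto the range of \<open>M\<close>, \<open>Y = P ** X\<close> and \<open>p i\<close> the squared length of \<open>P *v u i\<close>.
  By Pythagoras the bracket is the squared distance of \<open>M\<close> from \<open>Y\<close> plus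
  \<open>(rnorm r X)^2 - (norm Y)^2\<close>. The numbers \<open>p i\<close> are weights of total \<open>rank M\<close>, and both the
  second summand and the squared distance of \<open>Y\<close> from \<open>S\<close> are expressed by them exactly as in
  \<open>weighted_sum_gap\<close>. If \<open>singular_value X r = 0\<close>, then \<open>S = X\<close> and the bracket is the squared
  distance itself.
\<close>

theorem eckart_young_quadratic_growth:
  fixes X :: "real ^ 'm ^ 'n"
  assumes svd: "is_svd X u v" and r: "1 \<le> r" "r \<le> CARD('n)"
    and gap: "singular_value X r \<noteq> singular_value X (r + 1) \<or> singular_value X r = 0"
    and S: "S = (\<Sum>i = 1..r. singular_value X i *\<^sub>R outer (u i) (v i))"
  obtains C where "0 < C"
    "\<And>M. rank M \<le> r \<Longrightarrow> (norm (M - S))\<^sup>2 \<le> C * ((rnorm r X)\<^sup>2 - 2 * (X \<bullet> M) + (norm M)\<^sup>2)"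
proof (cases "singular_value X r = 0")
  case True
  have zero: "singular_value X i = 0" if "i \<ge> r" for i
    using singular_value_antimono[of r i X] singular_value_nonneg[of X i] True that r by simp
  have "X = (\<Sum>i = 1..CARD('n). singular_value X i *\<^sub>R outer (u i) (v i))"
    using svd unfolding is_svd_def by blast
  also have "\<dots> = S"
    unfolding S by (rule sum.mono_neutral_right) (use r zero in auto)
  finally have "X = S" .
  then have "(norm (M - S))\<^sup>2 = 1 * ((rnorm r X)\<^sup>2 - 2 * (X \<bullet> M) + (norm M)\<^sup>2)" for M
    using truncated_svd_inner(2)[OF svd r(2) S]
    by (simp add: power2_norm_eq_inner inner_diff_left inner_diff_right inner_commute)
  then show ?thesis
    using that[of 1] by simp
next
  case False
  let ?n = "CARD('n)"
  let ?s = "singular_value X"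
  let ?q = "\<lambda>i. (?s i)\<^sup>2"
  have u: "orthonormal_family ?n u" and v: "orthonormal_family ?n v"
    and X: "X = (\<Sum>i = 1..?n. ?s i *\<^sub>R outer (u i) (v i))"
    using svd unfolding is_svd_def by blast+
  have q_anti: "?q j \<le> ?q i" if "1 \<le> i" "i \<le> j" for i j
    using singular_value_antimono[OF that, of X] singular_value_nonneg[of X j] by (rule power_mono)
  have "?s (r + 1) < ?s r"
    using gap False singular_value_antimono[of r "r + 1" X] r by simp
  then have q_less: "?q (r + 1) < ?q r"
    by (rule power_strict_mono) (auto simp: singular_value_nonneg)
  \<comment> \<open>Twice the constant of \<open>weighted_sum_gap\<close>, since the triangle inequality for squares loses a factor 2.\<close>
  define C where "C = 4 * ?q r / (?q r - ?q (r + 1))"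
  have C2: "2 \<le> C"
    using q_less zero_le_power2[of "?s (r + 1)"] by (simp add: C_def le_divide_eq)
  have "(norm (M - S))\<^sup>2 \<le> C * ((rnorm r X)\<^sup>2 - 2 * (X \<bullet> M) + (norm M)\<^sup>2)" if rank: "rank M \<le> r" for M
  proof -
    obtain P where P: "transpose P = P" "P ** P = P" "P ** M = M"
      "(\<Sum>i = 1..?n. u i \<bullet> (P *v u i)) = real (rank M)"
      using range_projection[of M] u by metis
    define Y where "Y = P ** X"
    define p where "p i = u i \<bullet> (P *v u i)" for i
    have PP: "(P *v x) \<bullet> (P *v x) = x \<bullet> (P *v x)" for x
      by (metis P(1,2) inner_matrix_vector_mult matrix_vector_mul_assoc)
    have uu: "u i \<bullet> u i = 1" if "i \<in> {1..?n}" for i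
      using orthonormal_familyD[OF u that that] by simp
    have p_residual: "(P *v u i - u i) \<bullet> (P *v u i - u i) = 1 - p i" if "i \<in> {1..?n}" for i
      using PP[of "u i"] uu[OF that] by (simp add: inner_diff_left inner_diff_right inner_commute p_def)
    have p0: "0 \<le> p i" if "i \<in> {1..?n}" for i
      unfolding p_def using PP[of "u i"] inner_ge_zero[of "P *v u i"] by simp
    have p1: "p i \<le> 1" if "i \<in> {1..?n}" for i
      using p_residual[OF that] inner_ge_zero[of "P *v u i - u i"] by simp
    have Y: "Y = (\<Sum>i = 1..?n. outer (?s i *\<^sub>R (P *v u i)) (v i))"
      unfolding Y_def
      by (subst X) (simp add: matrix_mult_sum_right matrix_mult_outer outer_scaleR_left[symmetric]
          matrix_vector_mult_scaleR)
    have norm_Y: "(norm Y)\<^sup>2 = (\<Sum>i = 1..?n. ?q i * p i)"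
      unfolding power2_norm_eq_inner
      by (subst (1 2) Y) (simp add: inner_sum_outer[OF v, simplified] PP p_def power2_eq_square mult.assoc)
    have "Y - S = (\<Sum>i = 1..?n. outer (?s i *\<^sub>R (P *v u i) - (if i \<le> r then ?s i *\<^sub>R u i else 0)) (v i))"
      unfolding Y S sum_outer_truncate[OF r(2)] by (simp add: outer_diff_left sum_subtractf)
    then have "(norm (Y - S))\<^sup>2 = (\<Sum>i = 1..?n.
        (?s i *\<^sub>R (P *v u i) - (if i \<le> r then ?s i *\<^sub>R u i else 0)) \<bullet>
        (?s i *\<^sub>R (P *v u i) - (if i \<le> r then ?s i *\<^sub>R u i else 0)))"
      unfolding power2_norm_eq_inner by (simp only: inner_sum_outer[OF v])
    also have "\<dots> = (\<Sum>i = 1..?n. if i \<le> r then ?q i * (1 - p i) else ?q i * p i)"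
    proof (rule sum.cong)
      fix i assume i: "i \<in> {1..?n}"
      have "(?s i *\<^sub>R (P *v u i) - ?s i *\<^sub>R u i) \<bullet> (?s i *\<^sub>R (P *v u i) - ?s i *\<^sub>R u i)
          = ?q i * ((P *v u i - u i) \<bullet> (P *v u i - u i))"
        by (simp add: scaleR_diff_right[symmetric] power2_eq_square)
      then show "(?s i *\<^sub>R (P *v u i) - (if i \<le> r then ?s i *\<^sub>R u i else 0)) \<bullet>
          (?s i *\<^sub>R (P *v u i) - (if i \<le> r then ?s i *\<^sub>R u i else 0))
          = (if i \<le> r then ?q i * (1 - p i) else ?q i * p i)"
        using p_residual[OF i] PP[of "u i"] by (simp add: p_def power2_eq_square)
    qed simp
    also have "\<dots> = (\<Sum>i = 1..r. ?q i * (1 - p i)) + (\<Sum>i = r+1..?n. ?q i * p i)"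
      using r sum.ub_add_nat[of 1 r "\<lambda>i. if i \<le> r then ?q i * (1 - p i) else ?q i * p i" "?n - r"]
      by simp
    finally have norm_YS: "(norm (Y - S))\<^sup>2 = \<dots>" .
    have YM: "X \<bullet> M = Y \<bullet> M"
      by (simp add: Y_def inner_matrix_mult_left P)
    have gap_eq: "(rnorm r X)\<^sup>2 - 2 * (X \<bullet> M) + (norm M)\<^sup>2
        = (norm (M - Y))\<^sup>2 + ((rnorm r X)\<^sup>2 - (norm Y)\<^sup>2)"
      unfolding YM by (simp add: power2_norm_eq_inner inner_diff_left inner_diff_right inner_commute)
    have "(?q r - ?q (r + 1)) * (norm (Y - S))\<^sup>2 \<le> 2 * ?q r * ((rnorm r X)\<^sup>2 - (norm Y)\<^sup>2)"
      unfolding norm_YS norm_Y rnorm_power2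
      using r q_anti p0 p1 P(4) rank
      by (intro weighted_sum_gap) (auto simp: p_def)
    then have "2 * (norm (Y - S))\<^sup>2 \<le> C * ((rnorm r X)\<^sup>2 - (norm Y)\<^sup>2)"
      using q_less by (simp add: C_def field_simps)
    moreover have "2 * (norm (M - Y))\<^sup>2 \<le> C * (norm (M - Y))\<^sup>2"
      using C2 by (rule mult_right_mono) simp
    moreover have "(norm (M - S))\<^sup>2 \<le> 2 * (norm (M - Y))\<^sup>2 + 2 * (norm (Y - S))\<^sup>2"
    proof -
      have "norm (M - S) \<le> norm (M - Y) + norm (Y - S)"
        using norm_triangle_ineq[of "M - Y" "Y - S"] by simp
      then have "(norm (M - S))\<^sup>2 \<le> (norm (M - Y) + norm (Y - S))\<^sup>2"
        by (rule power_mono) simp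
      also have "\<dots> \<le> 2 * (norm (M - Y))\<^sup>2 + 2 * (norm (Y - S))\<^sup>2"
        using sum_squares_bound[of "norm (M - Y)" "norm (Y - S)"] by (simp add: power2_sum)
      finally show ?thesis .
    qed
    ultimately show ?thesis
      unfolding gap_eq by (simp add: distrib_left)
  qed
  then show ?thesis
    using that[of C] C2 by simp
qed

section \<open>Conjugates of closed proper convex functions\<close>

lemma closed_proper_convexD:
  assumes "closed_proper_convex g"
  shows "closed (epi g)" "convex (epi g)" "g x \<noteq> - \<infinity>"
  using assms by (auto simp: closed_proper_convex_def)

lemma closed_proper_convex_finite_point:
  assumes "closed_proper_convex g"
  obtains x s where "g x = ereal s"
proof -
  obtain x t where "(x, t) \<in> epi g"
    using assms unfolding closed_proper_convex_def by (metis ex_in_conv surj_pair)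
  then show ?thesis
    using that closed_proper_convexD(3)[OF assms, of x] by (cases "g x") (auto simp: epi_def)
qed

lemma conjugate_le_iff_affine_minorant:
  assumes "closed_proper_convex g"
  shows "conjugate g p \<le> ereal c \<longleftrightarrow> (\<forall>x. ereal (p \<bullet> x - c) \<le> g x)"
proof -
  have "ereal (p \<bullet> x) - g x \<le> ereal c \<longleftrightarrow> ereal (p \<bullet> x - c) \<le> g x" for x
    using closed_proper_convexD(3)[OF assms, of x] by (cases "g x") auto
  then show ?thesis
    by (simp add: conjugate_def SUP_le_iff)
qed

text \<open>
  Strict separation of a point below the graph from the epigraph. The last coordinate \<open>q\<close> of the
  normal vector cannot be negative since the epigraph is unbounded upwards.
\<close>

lemma epi_separation:
  fixes g :: "'a::euclidean_space \<Rightarrow> ereal"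
  assumes g: "closed_proper_convex g" and t: "ereal t < g x0"
  obtains p q b where "p \<bullet> x0 + q * t < b" "0 \<le> q"
    "\<And>x s. g x \<le> ereal s \<Longrightarrow> b < p \<bullet> x + q * s"
proof -
  have "(x0, t) \<notin> epi g"
    using t by (auto simp: epi_def)
  then obtain a b where ab: "a \<bullet> (x0, t) < b" "\<And>z. z \<in> epi g \<Longrightarrow> b < a \<bullet> z"
    using separating_hyperplane_closed_point[OF closed_proper_convexD(2,1)[OF g]] by blast
  obtain p q where a: "a = (p, q)"
    by (cases a)
  have above: "b < p \<bullet> x + q * s" if "g x \<le> ereal s" for x s
    using ab(2)[of "(x, s)"] that by (simp add: a epi_def inner_prod_def)
  obtain x1 s1 where s1: "g x1 = ereal s1"
    using closed_proper_convex_finite_point[OF g] .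
  have "0 \<le> q"
  proof (rule ccontr)
    assume q: "\<not> 0 \<le> q"
    define s where "s = max s1 ((b - p \<bullet> x1) / q)"
    have "g x1 \<le> ereal s"
      by (simp add: s1 s_def)
    then have "b < p \<bullet> x1 + q * s"
      by (rule above)
    moreover have "q * s \<le> q * ((b - p \<bullet> x1) / q)"
      using q by (intro mult_left_mono_neg) (auto simp: s_def)
    ultimately show False
      using q by simp
  qed
  moreover have "p \<bullet> x0 + q * t < b"
    using ab(1) by (simp add: a inner_prod_def)
  ultimately show ?thesis
    using above that by blast
qed

lemma affine_minorant_nonvertical:
  fixes g :: "'a::euclidean_space \<Rightarrow> ereal"
  assumes g: "closed_proper_convex g" and q: "0 < q"
    and below: "p \<bullet> x0 + q * t < b"
    and above: "\<And>x s. g x \<le> ereal s \<Longrightarrow> b < p \<bullet> x + q * s"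
  obtains p' c where "\<And>x. ereal (p' \<bullet> x - c) \<le> g x" "t < p' \<bullet> x0 - c"
proof (rule that[of "- (p /\<^sub>R q)" "- (b / q)"])
  fix x
  show "ereal (- (p /\<^sub>R q) \<bullet> x - - (b / q)) \<le> g x"
  proof (cases "g x")
    case (real s)
    then show ?thesis
      using above[of x s] q by (simp add: field_simps)
  qed (use closed_proper_convexD(3)[OF g, of x] in auto)
next
  show "t < - (p /\<^sub>R q) \<bullet> x0 - - (b / q)"
    using below q by (simp add: field_simps)
qed

text \<open>
  At a point where \<open>g\<close> is finite, a hyperplane that separates a lower point on the same vertical
  line from the epigraph cannot be vertical, so it is the graph of an affine minorant.
\<close>

lemma affine_minorant_exists:
  fixes g :: "'a::euclidean_space \<Rightarrow> ereal"
  assumes g: "closed_proper_convex g"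
  obtains p c where "\<And>x. ereal (p \<bullet> x - c) \<le> g x"
proof -
  obtain x1 s where s: "g x1 = ereal s"
    using closed_proper_convex_finite_point[OF g] .
  have "ereal (s - 1) < g x1"
    using s by simp
  then obtain p q b where pqb: "p \<bullet> x1 + q * (s - 1) < b" "0 \<le> q"
    "\<And>x s. g x \<le> ereal s \<Longrightarrow> b < p \<bullet> x + q * s"
    by (rule epi_separation[OF g]) (rule that)
  have "q * (s - 1) < q * s"
    using pqb(1) pqb(3)[of x1 s] s by simp
  then have q: "0 < q"
    by (simp add: algebra_simps)
  show ?thesis
    by (rule affine_minorant_nonvertical[OF g q pqb(1)], erule pqb(3), rule that)
qed

text \<open>
  The Fenchel-Moreau theorem in terms of affine minorants. Where \<open>g\<close> is infinite the
  separating hyperplane may be vertical. It then is the zero set of an affine function that is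
  negative on the domain of \<open>g\<close> and positive at \<open>x0\<close>, and adding a large multiple \<open>k\<close> of this
  function to any affine minorant lifts the minorant above \<open>t\<close> at \<open>x0\<close>.
\<close>

theorem affine_minorant_above:
  fixes g :: "'a::euclidean_space \<Rightarrow> ereal"
  assumes g: "closed_proper_convex g" and t: "ereal t < g x0"
  obtains p c where "\<And>x. ereal (p \<bullet> x - c) \<le> g x" "t < p \<bullet> x0 - c"
proof -
  note gm = closed_proper_convexD(3)[OF g]
  obtain p q b where pqb: "p \<bullet> x0 + q * t < b" "0 \<le> q"
    "\<And>x s. g x \<le> ereal s \<Longrightarrow> b < p \<bullet> x + q * s"
    by (rule epi_separation[OF g t]) (rule that)
  show ?thesis
  proof (cases "q = 0")
    case False
    then have q: "0 < q" using pqb(2) by simp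
    show ?thesis
      by (rule affine_minorant_nonvertical[OF g q pqb(1)], erule pqb(3), rule that)
  next
    case True
    obtain p0 c0 where pc: "\<And>x. ereal (p0 \<bullet> x - c0) \<le> g x"
      using affine_minorant_exists[OF g] by blast
    define d where "d = b - p \<bullet> x0"
    have d: "0 < d"
      using pqb(1) True by (simp add: d_def)
    define k where "k = max 0 ((t + 1 - (p0 \<bullet> x0 - c0)) / d)"
    have k0: "0 \<le> k"
      by (simp add: k_def)
    have "(t + 1 - (p0 \<bullet> x0 - c0)) / d * d \<le> k * d"
      using d by (intro mult_right_mono) (auto simp: k_def)
    then have kd: "t + 1 - (p0 \<bullet> x0 - c0) \<le> k * d"
      using d by simp
    show ?thesis
    proof (rule that[of "p0 - k *\<^sub>R p" "c0 - k * b"])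
      fix x
      show "ereal ((p0 - k *\<^sub>R p) \<bullet> x - (c0 - k * b)) \<le> g x"
      proof (cases "g x")
        case (real s)
        then have "b \<le> p \<bullet> x"
          using pqb(3)[of x s] True by simp
        then have "k * b \<le> k * (p \<bullet> x)"
          using k0 by (rule mult_left_mono)
        then show ?thesis
          using pc[of x] real by (simp add: inner_diff_left)
      qed (use gm[of x] in auto)
    next
      show "t < (p0 - k *\<^sub>R p) \<bullet> x0 - (c0 - k * b)"
        using kd by (simp add: d_def inner_diff_left algebra_simps)
    qed
  qed
qed

lemma conjugate_not_MInf:
  assumes "closed_proper_convex g"
  shows "conjugate g p \<noteq> - \<infinity>"
proof
  assume "conjugate g p = - \<infinity>"
  then have "conjugate g p \<le> ereal c" for c
    by simp
  then have *: "ereal (p \<bullet> x - c) \<le> g x" for x c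
    using assms conjugate_le_iff_affine_minorant[of g p c] by simp
  obtain x s where "g x = ereal s"
    using closed_proper_convex_finite_point[OF assms] .
  then show False
    using *[of x "p \<bullet> x - s - 1"] by simp
qed

lemma conjugate_finite_somewhere:
  fixes g :: "'a::euclidean_space \<Rightarrow> ereal"
  assumes "closed_proper_convex g"
  obtains p where "conjugate g p < \<infinity>"
proof -
  obtain p c where "\<And>x. ereal (p \<bullet> x - c) \<le> g x"
    using affine_minorant_exists[OF assms] by blast
  then have le: "conjugate g p \<le> ereal c"
    using assms by (simp add: conjugate_le_iff_affine_minorant)
  show ?thesis
    by (rule that[OF le_less_trans[OF le]]) simp
qed

lemma conjugate_convex:
  assumes g: "closed_proper_convex g" and "conjugate g p \<le> ereal a" "conjugate g q \<le> ereal b"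
    and t: "0 \<le> t" "t \<le> 1"
  shows "conjugate g ((1 - t) *\<^sub>R p + t *\<^sub>R q) \<le> ereal ((1 - t) * a + t * b)"
proof -
  note gm = closed_proper_convexD(3)[OF g]
  have ab: "ereal (p \<bullet> x - a) \<le> g x" "ereal (q \<bullet> x - b) \<le> g x" for x
    using assms(2,3) by (auto simp: conjugate_le_iff_affine_minorant[OF g])
  have "ereal (((1 - t) *\<^sub>R p + t *\<^sub>R q) \<bullet> x - ((1 - t) * a + t * b)) \<le> g x" for x
  proof (cases "g x")
    case (real s)
    then have "p \<bullet> x - a \<le> s" "q \<bullet> x - b \<le> s"
      using ab[of x] by auto
    then have "(1 - t) * (p \<bullet> x - a) + t * (q \<bullet> x - b) \<le> s"
      using t by (intro convex_bound_le) auto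
    then show ?thesis
      using real by (simp add: inner_add_left algebra_simps)
  qed (use gm[of x] in auto)
  then show ?thesis
    by (simp add: conjugate_le_iff_affine_minorant[OF g])
qed

lemma biconjugate_le:
  fixes g :: "'a::euclidean_space \<Rightarrow> ereal"
  assumes g: "closed_proper_convex g"
    and bound: "\<And>p. ereal (p \<bullet> x - c) \<le> conjugate g p"
  shows "g x \<le> ereal c"
proof (rule ccontr)
  assume "\<not> g x \<le> ereal c"
  then obtain p d where pd: "\<And>y. ereal (p \<bullet> y - d) \<le> g y" "c < p \<bullet> x - d"
    using affine_minorant_above[OF g, of c x] by (auto simp: not_le)
  then have "conjugate g p \<le> ereal d"
    using g by (simp add: conjugate_le_iff_affine_minorant)
  with bound[of p] have "ereal (p \<bullet> x - c) \<le> ereal d"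
    by (rule order_trans)
  then show False
    using pd(2) by simp
qed

text \<open>
  The first-order condition at a minimizer of the conjugate plus a function that has slope \<open>S\<close> at \<open>D\<close>.
  Moving from \<open>D\<close> by \<open>t *\<^sub>R E\<close> increases \<open>h\<close> by at most \<open>t * (S \<bullet> E)\<close> up to order \<open>t^2\<close>, and by
  convexity increases the conjugate by at most \<open>t\<close> times its full increment, so letting
  \<open>t\<close> tend to 0 shows that \<open>S\<close> is a subgradient of the conjugate at \<open>- D\<close>.
  By the Fenchel-Moreau theorem this means equality in the Fenchel-Young inequality.
\<close>

theorem conjugate_subgradient_of_minimizer:
  fixes g :: "'a::euclidean_space \<Rightarrow> ereal" and h :: "'a \<Rightarrow> real"
  assumes g: "closed_proper_convex g"
    and min: "\<And>D'. conjugate g (- D) + ereal (h D) \<le> conjugate g (- D') + ereal (h D')"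
    and smooth: "\<And>E. h (D + E) \<le> h D + S \<bullet> E + K * (norm E)\<^sup>2"
  obtains a where "conjugate g (- D) = ereal a" "g S = ereal (- (D \<bullet> S) - a)"
proof -
  obtain p0 where "conjugate g p0 < \<infinity>"
    using conjugate_finite_somewhere[OF g] by blast
  then have "conjugate g (- D) \<noteq> \<infinity>"
    using min[of "- p0"] by auto
  then obtain a where a: "conjugate g (- D) = ereal a"
    using conjugate_not_MInf[OF g, of "- D"] by (cases "conjugate g (- D)") auto
  have sub: "ereal (p \<bullet> S - (- (D \<bullet> S) - a)) \<le> conjugate g p" for p
  proof (cases "conjugate g p")
    case (real b)
    define E where "E = - p - D"
    have "0 \<le> (b - a + S \<bullet> E) + t * (K * (norm E)\<^sup>2)" if t: "0 < t" "t \<le> 1" for t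
    proof -
      have "(1 - t) *\<^sub>R (- D) + t *\<^sub>R p = - (D + t *\<^sub>R E)"
        by (simp add: E_def algebra_simps)
      then have "conjugate g (- (D + t *\<^sub>R E)) \<le> ereal ((1 - t) * a + t * b)"
        using conjugate_convex[OF g, of "- D" a p b t] a real t by simp
      then have "conjugate g (- (D + t *\<^sub>R E)) + ereal (h (D + t *\<^sub>R E))
          \<le> ereal ((1 - t) * a + t * b) + ereal (h (D + t *\<^sub>R E))"
        by (rule add_right_mono)
      with min[of "D + t *\<^sub>R E"]
      have "ereal a + ereal (h D) \<le> ereal ((1 - t) * a + t * b) + ereal (h (D + t *\<^sub>R E))"
        unfolding a by (rule order_trans)
      then have "a + h D \<le> (1 - t) * a + t * b + (h D + S \<bullet> (t *\<^sub>R E) + K * (norm (t *\<^sub>R E))\<^sup>2)"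
        using smooth[of "t *\<^sub>R E"] by simp
      then have "0 \<le> t * ((b - a + S \<bullet> E) + t * (K * (norm E)\<^sup>2))"
        by (simp add: algebra_simps power2_eq_square)
      then show ?thesis
        using t by (simp add: zero_le_mult_iff)
    qed
    then have "eventually (\<lambda>t. 0 \<le> (b - a + S \<bullet> E) + t * (K * (norm E)\<^sup>2)) (at_right 0)"
      by (intro eventually_at_rightI[of 0 1]) auto
    moreover have "((\<lambda>t. (b - a + S \<bullet> E) + t * (K * (norm E)\<^sup>2)) \<longlongrightarrow> (b - a + S \<bullet> E) + 0 * (K * (norm E)\<^sup>2)) (at_right 0)"
      by (intro tendsto_intros)
    ultimately have "0 \<le> (b - a + S \<bullet> E) + 0 * (K * (norm E)\<^sup>2)"
      by (intro tendsto_lowerbound[where F = "at_right (0::real)"]) auto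
    then show ?thesis
      using real by (simp add: E_def inner_diff_right inner_commute)
  qed (use conjugate_not_MInf[OF g, of p] in auto)
  have "g S \<le> ereal (- (D \<bullet> S) - a)"
    using g sub by (rule biconjugate_le)
  moreover have "ereal (- D \<bullet> S - a) \<le> g S"
    using a conjugate_le_iff_affine_minorant[OF g, where p = "- D" and c = a] by simp
  ultimately show ?thesis
    using that a by (simp add: order_antisym)
qed

section \<open>Strong duality for the rank-constrained problem\<close>

text \<open>
  If \<open>S\<close> solves the Eckart-Young problem for \<open>X\<close> with quadratic growth, then \<open>S\<close> is the slope at \<open>X\<close>
  of half the squared \<open>rnorm\<close>. Let \<open>T\<close> be a truncated SVD of \<open>X + E\<close>, so that \<open>T\<close> attains the maximum for
  \<open>X + E\<close>. Its value there exceeds its value in the problem for \<open>X\<close> by \<open>T \<bullet> E\<close>, which differs from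
  \<open>S \<bullet> E\<close> by \<open>W \<bullet> E\<close>. The value in the problem for \<open>X\<close> in turn falls short of the maximum
  by an amount at least quadratic in \<open>W = T - S\<close>, which absorbs \<open>W \<bullet> E\<close> up to a term quadratic in \<open>E\<close>.
\<close>

lemma rnorm_quadratic_upper_bound:
  fixes X S :: "real ^ 'm ^ 'n"
  assumes nm: "CARD('n) \<le> CARD('m)" and r: "r \<le> CARD('n)" and C: "0 < C"
    and growth: "\<And>M. rank M \<le> r \<Longrightarrow>
      (norm (M - S))\<^sup>2 \<le> C * ((rnorm r X)\<^sup>2 - 2 * (X \<bullet> M) + (norm M)\<^sup>2)"
  shows "(rnorm r (X + E))\<^sup>2 \<le> (rnorm r X)\<^sup>2 + 2 * (S \<bullet> E) + C * (norm E)\<^sup>2"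
proof -
  obtain u v where svd: "is_svd (X + E) u v"
    using svd_exists[OF nm] by blast
  define T where "T = (\<Sum>i = 1..r. singular_value (X + E) i *\<^sub>R outer (u i) (v i))"
  define W where "W = T - S"
  have "(rnorm r (X + E))\<^sup>2 = 2 * ((X + E) \<bullet> T) - (norm T)\<^sup>2"
    using truncated_svd_inner[OF svd r T_def] by simp
  then have value_T: "(rnorm r (X + E))\<^sup>2 = 2 * (X \<bullet> T) - (norm T)\<^sup>2 + 2 * (S \<bullet> E) + 2 * (W \<bullet> E)"
    by (simp add: W_def inner_add_left inner_diff_left inner_commute[of E T] inner_commute[of E S])
  have "rank T \<le> r"
    unfolding T_def by (rule rank_sum_outer_le)
  then have gW: "(norm W)\<^sup>2 \<le> C * ((rnorm r X)\<^sup>2 - 2 * (X \<bullet> T) + (norm T)\<^sup>2)"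
    unfolding W_def by (rule growth)
  \<comment> \<open>Young's inequality \<open>2 * (W \<bullet> E) \<le> C * (norm E)^2 + (norm W)^2 / C\<close>, multiplied by \<open>C\<close>.\<close>
  have "0 \<le> (norm (C *\<^sub>R E - W))\<^sup>2"
    by simp
  also have "\<dots> = C * (C * (norm E)\<^sup>2 - 2 * (W \<bullet> E)) + (norm W)\<^sup>2"
    unfolding power2_norm_eq_inner
    by (simp add: inner_diff_left inner_diff_right inner_commute[of E W] algebra_simps)
  finally have "C * (2 * (W \<bullet> E) - C * (norm E)\<^sup>2) \<le> (norm W)\<^sup>2"
    by (simp add: algebra_simps)
  with gW have "C * (2 * (W \<bullet> E) - C * (norm E)\<^sup>2)
      \<le> C * ((rnorm r X)\<^sup>2 - 2 * (X \<bullet> T) + (norm T)\<^sup>2)"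
    by (rule order_trans[rotated])
  then have "2 * (W \<bullet> E) - C * (norm E)\<^sup>2 \<le> (rnorm r X)\<^sup>2 - 2 * (X \<bullet> T) + (norm T)\<^sup>2"
    using C by simp
  then show ?thesis
    using value_T by simp
qed

theorem proposition3:
  fixes N D :: "real ^ 'm ^ 'n"
    and g :: "real ^ 'm ^ 'n \<Rightarrow> ereal"
    and r :: nat
  assumes "CARD('n) \<le> CARD('m)"
    and "1 \<le> r" and "r \<le> CARD('n)"
    and "closed_proper_convex g"
    and "\<exists>M. rank M \<le> r \<and> g M < \<infinity>"
    and "D \<in> minimizers (dual_objective r N g) UNIV"
    and "singular_value (N + D) r \<noteq> singular_value (N + D) (r + 1) \<or> singular_value (N + D) r = 0"
  shows "(INF M\<in>{M. rank M \<le> r}. primal_objective N g M) = - (INF D'. dual_objective r N g D') \<and>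
         (\<exists>S. svd_approx r (N + D) = {S} \<and>
              minimizers (primal_objective N g) {M. rank M \<le> r} = {S})"
proof -
  define X where "X = N + D"
  define G where "G M = (rnorm r X)\<^sup>2 - 2 * (X \<bullet> M) + (norm M)\<^sup>2" for M
  obtain u v where svd: "is_svd X u v"
    using svd_exists[OF assms(1)] by blast
  define S where "S = (\<Sum>i = 1..r. singular_value X i *\<^sub>R outer (u i) (v i))"
  obtain C where C: "0 < C" and
    growth: "\<And>M. rank M \<le> r \<Longrightarrow> (norm (M - S))\<^sup>2 \<le> C * G M"
    using eckart_young_quadratic_growth[OF svd assms(2,3) assms(7)[folded X_def] S_def]
    unfolding G_def by blast
  have G_nonneg: "0 \<le> G M" if "rank M \<le> r" for M
    using order_trans[OF zero_le_power2 growth[OF that]] C by (simp add: zero_le_mult_iff)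
  have eq_S: "M = S" if "rank M \<le> r" "G M \<le> 0" for M
  proof -
    have "C * G M \<le> 0"
      using C that(2) by (simp add: mult_nonneg_nonpos)
    with growth[OF that(1)] have "(norm (M - S))\<^sup>2 \<le> 0"
      by (rule order_trans)
    then show ?thesis by simp
  qed
  have svd_G: "rank T \<le> r \<and> G T = 0"
    if "is_svd X u' v'" "T = (\<Sum>i = 1..r. singular_value X i *\<^sub>R outer (u' i) (v' i))" for u' v' T
  proof
    show "rank T \<le> r"
      unfolding that(2) by (rule rank_sum_outer_le)
    show "G T = 0"
      using truncated_svd_inner[OF that(1) assms(3) that(2)] by (simp add: G_def)
  qed
  have rank_S: "rank S \<le> r" and G_S: "G S = 0"
    using svd_G[OF svd S_def] by auto
  have approx: "svd_approx r X = {S}"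
  proof
    show "svd_approx r X \<subseteq> {S}"
    proof
      fix T assume "T \<in> svd_approx r X"
      then obtain u' v' where "is_svd X u' v'"
        and T: "T = (\<Sum>i = 1..r. singular_value X i *\<^sub>R outer (u' i) (v' i))"
        unfolding svd_approx_def by blast
      then have "rank T \<le> r \<and> G T = 0"
        by (rule svd_G)
      then show "T \<in> {S}"
        using eq_S by simp
    qed
    show "{S} \<subseteq> svd_approx r X"
      unfolding svd_approx_def S_def using svd by blast
  qed

  define h where "h D' = 1 / 2 * (rnorm r (N + D'))\<^sup>2 - 1 / 2 * (norm N)\<^sup>2" for D'
  have dual: "dual_objective r N g D' = conjugate g (- D') + ereal (h D')" for D'
    by (simp add: dual_objective_def h_def)
  have min: "dual_objective r N g D \<le> dual_objective r N g D'" for D'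
    using assms(6) by (simp add: minimizers_def)
  have smooth: "h (D + E) \<le> h D + S \<bullet> E + C / 2 * (norm E)\<^sup>2" for E
    using rnorm_quadratic_upper_bound[OF assms(1,3) C growth[unfolded G_def], of E]
    by (simp add: h_def X_def add.assoc)
  obtain a where a: "conjugate g (- D) = ereal a" and gS: "g S = ereal (- (D \<bullet> S) - a)"
    using conjugate_subgradient_of_minimizer[OF assms(4) min[unfolded dual] smooth] .

  define V where "V = - a - h D"
  have "(INF D'. dual_objective r N g D') = dual_objective r N g D"
    by (rule antisym) (auto intro: INF_lower INF_greatest min)
  then have dual_value: "- (INF D'. dual_objective r N g D') = ereal V"
    by (simp add: dual a V_def)

  \<comment> \<open>Replacing \<open>g\<close> by its affine minorant with slope \<open>- D\<close> turns the primal objective into the Eckart-Young problem for \<open>X\<close>.\<close>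
  have objective: "1 / 2 * (norm (N - M))\<^sup>2 + (- (D \<bullet> M) - a) = V + 1 / 2 * G M" for M
    unfolding V_def h_def G_def X_def power2_norm_eq_inner
    by (simp add: inner_add_left inner_diff_left inner_diff_right inner_commute[of M N] field_simps)
  have young: "ereal (- (D \<bullet> M) - a) \<le> g M" for M
    using a conjugate_le_iff_affine_minorant[OF assms(4), of "- D" a] by simp
  have primal_ge: "ereal (V + 1 / 2 * G M) \<le> primal_objective N g M" for M
    using add_left_mono[OF young[of M], of "ereal (1 / 2 * (norm (N - M))\<^sup>2)"]
    unfolding primal_objective_def objective[symmetric] by simp
  have primal_S: "primal_objective N g S = ereal V"
    unfolding primal_objective_def gS using objective[of S] G_S by simp
  have V_le: "ereal V \<le> primal_objective N g M" if "rank M \<le> r" for M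
    using primal_ge[of M] G_nonneg[OF that] by (elim order_trans[rotated]) simp
  have "(INF M\<in>{M. rank M \<le> r}. primal_objective N g M) = ereal V"
  proof (rule antisym)
    show "(INF M\<in>{M. rank M \<le> r}. primal_objective N g M) \<le> ereal V"
      unfolding primal_S[symmetric] using rank_S by (intro INF_lower) simp
  qed (use V_le in \<open>auto intro: INF_greatest\<close>)
  moreover have "minimizers (primal_objective N g) {M. rank M \<le> r} = {S}"
  proof -
    have "M = S" if M: "rank M \<le> r" "primal_objective N g M \<le> primal_objective N g S" for M
    proof (rule eq_S)
      have "ereal (V + 1 / 2 * G M) \<le> ereal V"
        using primal_ge[of M] M(2) unfolding primal_S by (rule order_trans)
      then show "G M \<le> 0" by simp
    qed (fact M(1))
    then have "minimizers (primal_objective N g) {M. rank M \<le> r} \<subseteq> {S}"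
      unfolding minimizers_def using rank_S by blast
    moreover have "S \<in> minimizers (primal_objective N g) {M. rank M \<le> r}"
      unfolding minimizers_def using rank_S V_le by (simp add: primal_S)
    ultimately show ?thesis
      by blast
  qed
  ultimately show ?thesis
    using dual_value approx unfolding X_def by (intro conjI exI[of _ S]) simp_all
qed

end
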